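(* Let $G=(V,E)$ be an infinite connected graph satisfying $\mathcal{V}(c_u,d_u)$ and $\mathcal{L}(c_l,d_l)$. Let $\alpha>\alpha_{\ast\ast}$, where $\alpha_{\ast\ast}:=3d_u-d_l/2$, and let $c_\alpha>0$. Then there exists $p_{\ast\ast}>0$, depending only on $G,\alpha,c_\alpha$, such that for every probability measure $\mathbb{P}$ on $\{0,1\}^V$ satisfying $\mathcal{D}(\alpha,c_\alpha)$ and $\sup_{x\in V}\mathbb{P}[Y_x=1]<p_{\ast\ast}$, the graph contains $\mathbb{P}$-almost surely no infinite open cluster. Moreover, for every $\theta>0$ there is a threshold $p_\theta>0$, depending only on $\theta, G,\alpha,c_\alpha$ (and not on $\mathbb{P}$), such that if $\mathbb{P}$ satisfies $\mathcal{D}(\alpha,c_\alpha)$ and $\sup_{x\in V}\mathbb{P}[Y_x=1]<p_\theta$, then for any fixed $z\in V$ $$\lim_{r\to\infty}r^\theta\,\mathbb{P}[|\mathcal{C}_z|>r]=0,$$ where $\mathcal{C}_z$ denotes the open connected component containing $z$.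
   Context: Graph distance is denoted $d(\cdot,\cdot)$, and $B(x,r)=\{w\in V: d(x,w)\le r\}$. $\mathcal{V}(c_u,d_u)$ ($c_u,d_u>0$): $|B(x,r)|\le c_u r^{d_u}$ for all $r\ge 1$, $x\in V$. $\mathcal{L}(c_l,d_l)$ ($c_l,d_l>0$): $|B(x,r)|\ge c_l r^{d_l}$ for all real $r\ge 1$ and $x\in V$. (Every infinite connected graph satisfies this with $d_l=1$.) $\{0,1\}^V$ carries the $\sigma$-algebra generated by the projections $Y_x(\omega)=\omega(x)$; a vertex $x$ is open if $Y_x=1$. Open clusters are the connected components of the subgraph induced by the open vertices. $\mathcal{D}(\alpha,c_\alpha)$: for every $x\in V$, $r\ge 1$ and events $\mathcal{G}\in\sigma(Y_z: z\in B(x,r))$, $\mathcal{G}'\in\sigma(Y_w: d(w,x)\ge 2r)$, one has $\mathbb{P}(\mathcal{G}\cap\mathcal{G}')\le(\mathbb{P}(\mathcal{G})+c_\alpha r^{-\alpha})\,\mathbb{P}(\mathcal{G}')$. *)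

theory Defs
  imports "HOL-Probability.Probability"
begin

text \<open>
  A graph is given by its adjacency relation \<open>E\<close> on the vertex type \<open>'v\<close>, so that \<open>V = UNIV\<close>.
\<close>

definition simple_graph :: "'v rel \<Rightarrow> bool" where
  "simple_graph E \<longleftrightarrow> sym E \<and> irrefl E"

definition connected_graph :: "'v rel \<Rightarrow> bool" where
  "connected_graph E \<longleftrightarrow> (\<forall>x y. (x, y) \<in> E\<^sup>*)"

text \<open>The length of a shortest walk; only meaningful if \<open>y\<close> is reachable from \<open>x\<close>.\<close>

definition gdist :: "'v rel \<Rightarrow> 'v \<Rightarrow> 'v \<Rightarrow> nat" where
  "gdist E x y = (LEAST n. (x, y) \<in> E ^^ n)"

definition gball :: "'v rel \<Rightarrow> 'v \<Rightarrow> real \<Rightarrow> 'v set" where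
  "gball E x r = {w. real (gdist E x w) \<le> r}"

text \<open>
  Since \<open>card\<close> of an infinite set is 0, finiteness of the balls is part of the upper bound, and an
  infinite ball satisfies every lower bound.
\<close>

definition volume_upper :: "'v rel \<Rightarrow> real \<Rightarrow> real \<Rightarrow> bool" where
  "volume_upper E c d \<longleftrightarrow>
     (\<forall>x. \<forall>r\<ge>1. finite (gball E x r) \<and> real (card (gball E x r)) \<le> c * r powr d)"

definition volume_lower :: "'v rel \<Rightarrow> real \<Rightarrow> real \<Rightarrow> bool" where
  "volume_lower E c d \<longleftrightarrow>
     (\<forall>x. \<forall>r\<ge>1. infinite (gball E x r) \<or> c * r powr d \<le> real (card (gball E x r)))"

text \<open>Configurations in \<open>{0,1}\<^sup>V\<close> are Boolean functions; \<open>True\<close> stands for 1 (open).\<close>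

type_synonym 'v config = "'v \<Rightarrow> bool"

definition Y :: "'v \<Rightarrow> 'v config \<Rightarrow> bool" where
  "Y x \<omega> = \<omega> x"

definition sigma_Y :: "'v set \<Rightarrow> 'v config set set" where
  "sigma_Y A = sigma_sets UNIV {Y z -` B | z B. z \<in> A}"

definition config_law :: "'v config measure \<Rightarrow> bool" where
  "config_law P \<longleftrightarrow> prob_space P \<and> space P = UNIV \<and> sets P = sigma_Y UNIV"

definition decoupling :: "'v rel \<Rightarrow> real \<Rightarrow> real \<Rightarrow> 'v config measure \<Rightarrow> bool" where
  "decoupling E \<alpha> c P \<longleftrightarrow>
     (\<forall>x. \<forall>r\<ge>1. \<forall>G \<in> sigma_Y (gball E x r). \<forall>G' \<in> sigma_Y {w. 2 * r \<le> real (gdist E w x)}.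
        measure P (G \<inter> G') \<le> (measure P G + c * r powr (- \<alpha>)) * measure P G')"

text \<open>The cluster of a closed vertex is empty, since that vertex is not in the open subgraph.\<close>

definition open_cluster :: "'v rel \<Rightarrow> 'v config \<Rightarrow> 'v \<Rightarrow> 'v set" where
  "open_cluster E \<omega> z = (if Y z \<omega> then (Restr E {x. Y x \<omega>})\<^sup>* `` {z} else {})"

definition open_clusters :: "'v rel \<Rightarrow> 'v config \<Rightarrow> 'v set set" where
  "open_clusters E \<omega> = open_cluster E \<omega> ` {z. Y z \<omega>}"

text \<open>\<open>|A| > r\<close>, where an infinite set exceeds every real.\<close>

definition larger_than :: "'v set \<Rightarrow> real \<Rightarrow> bool" where
  "larger_than A r \<longleftrightarrow> infinite A \<or> real (card A) > r"

end

theory Submission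
  imports Defs "HOL-Real_Asymp.Real_Asymp"
begin

text \<open>
  Let \<open>q(n)\<close> be the supremum over \<open>x\<close> of the probability that \<open>x\<close> is joined by an open path to
  distance \<open>n\<close>. An open path from \<open>x\<close> to distance \<open>4n\<close> passes through some \<open>y\<close> at distance \<open>3n\<close>
  from \<open>x\<close>, and both \<open>x\<close> and \<open>y\<close> are then joined to distance \<open>n\<close> from themselves. The two events
  depend only on \<open>B(x,n)\<close> and on vertices at distance at least \<open>2n\<close> from \<open>x\<close>, so decoupling and a
  union bound give \<open>q(4n) \<le> c\<^sub>u (3n)\<^bsup>d\<^sub>u\<^esup> (q(n) + c\<^sub>\<alpha> n\<^bsup>-\<alpha>\<^esup>) q(n)\<close>. Since \<open>d\<^sub>l \<le> d\<^sub>u\<close> forces \<open>\<alpha> > d\<^sub>u\<close>, for every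
  \<open>\<beta> > d\<^sub>u\<close> the bound \<open>q(n) \<le> n\<^bsup>-\<beta>\<^esup>\<close> propagates from \<open>n\<close> to \<open>4n\<close> once \<open>n\<close> is large. At the initial
  scale it is enforced by the smallness of the one-point probabilities.
\<close>

section \<open>Graph distance\<close>

locale connected_sym_graph =
  fixes E :: "'v rel"
  assumes sym_E: "sym E" and connected_E: "connected_graph E"
begin

lemma gdist_walk: "(x, y) \<in> E ^^ gdist E x y"
proof -
  have "(x, y) \<in> E\<^sup>*" using connected_E by (simp add: connected_graph_def)
  then obtain n where "(x, y) \<in> E ^^ n" by (auto simp: rtrancl_power)
  then show ?thesis unfolding gdist_def by (rule LeastI)
qed

lemma gdist_le: "(x, y) \<in> E ^^ n \<Longrightarrow> gdist E x y \<le> n"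
  unfolding gdist_def by (rule Least_le)

lemma gdist_self [simp]: "gdist E x x = 0"
  using gdist_le[of x x 0] by simp

lemma gdist_triangle: "gdist E x z \<le> gdist E x y + gdist E y z"
  by (rule gdist_le) (metis gdist_walk relpow_add relcompI)

lemma gdist_edge: "(y, z) \<in> E \<Longrightarrow> gdist E x z \<le> Suc (gdist E x y)"
  using gdist_triangle[of x z y] gdist_le[of y z 1] by simp

lemma gdist_commute: "gdist E x y = gdist E y x"
proof -
  have conv: "(b, a) \<in> E ^^ n" if "(a, b) \<in> E ^^ n" for a b n
    using that
  proof (induction n arbitrary: b)
    case (Suc n)
    then obtain c where "(a, c) \<in> E ^^ n" "(c, b) \<in> E" by auto
    then have "(b, c) \<in> E" "(c, a) \<in> E ^^ n" using Suc.IH sym_E by (auto dest: symD)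
    then show ?case by (rule relpow_Suc_I2)
  qed simp
  show ?thesis by (rule antisym) (rule gdist_le, rule conv, rule gdist_walk)+
qed

section \<open>Arms\<close>

text \<open>The path is confined to the ball, so that the event depends only on the coordinates in
  \<open>gball E x n\<close>, as decoupling requires.\<close>

definition arm :: "'v \<Rightarrow> nat \<Rightarrow> 'v config set" where
  "arm x n = {\<omega>. \<omega> x \<and> (\<exists>y. gdist E x y = n \<and> (x, y) \<in> (Restr E ({w. \<omega> w} \<inter> gball E x n))\<^sup>*)}"

text \<open>An edge raises the distance from \<open>x\<close> by at most one, so a walk cannot jump
  over the sphere of radius \<open>n\<close>. The second alternative, a walk that is still strictly
  inside, carries the induction.\<close>

lemma exit_ball:
  assumes "(x, y) \<in> (Restr E S)\<^sup>*"
  shows "(\<exists>w. gdist E x w = n \<and> (x, w) \<in> (Restr E (S \<inter> gball E x n))\<^sup>*)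
       \<or> gdist E x y < n \<and> (x, y) \<in> (Restr E (S \<inter> gball E x n))\<^sup>*"
  using assms
proof (induction rule: rtrancl_induct)
  case base
  show ?case by (cases "n = 0") (auto intro!: exI[of _ x])
next
  case (step y z)
  show ?case
    using step.IH
  proof
    assume y: "gdist E x y < n \<and> (x, y) \<in> (Restr E (S \<inter> gball E x n))\<^sup>*"
    have "gdist E x z \<le> n" using gdist_edge[of y z x] step.hyps y by auto
    moreover from this have "(y, z) \<in> Restr E (S \<inter> gball E x n)"
      using step.hyps y by (auto simp: gball_def)
    then have "(x, z) \<in> (Restr E (S \<inter> gball E x n))\<^sup>*" using y by (auto intro: rtrancl_into_rtrancl)
    ultimately show ?thesis by (metis le_neq_implies_less)
  qed simp
qed

lemma arm_if_path:
  assumes "\<omega> x" "(x, y) \<in> (Restr E {w. \<omega> w})\<^sup>*" "n \<le> gdist E x y"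
  shows "\<omega> \<in> arm x n"
  using exit_ball[OF assms(2), of n] assms by (auto simp: arm_def)

lemma arm_split: "arm x (4 * n) \<subseteq> (\<Union>y\<in>{y. gdist E x y = 3 * n}. arm x n \<inter> arm y n)"
proof
  fix \<omega> assume "\<omega> \<in> arm x (4 * n)"
  then obtain w where w: "\<omega> x" "gdist E x w = 4 * n"
      "(x, w) \<in> (Restr E ({w. \<omega> w} \<inter> gball E x (4 * n)))\<^sup>*"
    by (auto simp: arm_def)
  let ?R = "Restr E {w. \<omega> w}"
  have xw: "(x, w) \<in> ?R\<^sup>*" using w(3) by (rule rtrancl_mono[THEN subsetD, rotated]) auto
  obtain y where y: "gdist E x y = 3 * n" "(x, y) \<in> (Restr E ({w. \<omega> w} \<inter> gball E x (3 * n)))\<^sup>*"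
    using exit_ball[OF xw, of "3 * n"] w(2) by auto
  have xy: "(x, y) \<in> ?R\<^sup>*" using y(2) by (rule rtrancl_mono[THEN subsetD, rotated]) auto
  \<comment> \<open>No path has to be cut at \<open>y\<close>: by symmetry, going back to
    \<open>x\<close> and on to \<open>w\<close> joins \<open>y\<close> to \<open>w\<close> just as
    well.\<close>
  have "sym ?R" using sym_E by (auto simp: sym_def)
  then have "(y, w) \<in> ?R\<^sup>*" using xy xw by (meson sym_rtrancl symD rtrancl_trans)
  moreover have "\<omega> y" using xy w(1) by (cases rule: rtrancl.cases) auto
  moreover have "n \<le> gdist E y w" using gdist_triangle[of x w y] w(2) y(1) by simp
  ultimately have "\<omega> \<in> arm y n" by (blast intro: arm_if_path)
  moreover have "\<omega> \<in> arm x n" using arm_if_path[OF w(1) xw] w(2) by simp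
  ultimately show "\<omega> \<in> (\<Union>y\<in>{y. gdist E x y = 3 * n}. arm x n \<inter> arm y n)" using y(1) by blast
qed

text \<open>A cluster with more vertices than the ball must leave it, and a path to a vertex outside
  contains an arm.\<close>

lemma arm_if_larger:
  assumes "finite (gball E z n)" "real (card (gball E z n)) \<le> r" "larger_than (open_cluster E \<omega> z) r"
  shows "\<omega> \<in> arm z n"
proof (cases "\<omega> z")
  case True
  have "\<not> open_cluster E \<omega> z \<subseteq> gball E z n"
  proof
    assume sub: "open_cluster E \<omega> z \<subseteq> gball E z n"
    have "card (open_cluster E \<omega> z) \<le> card (gball E z n)" using assms(1) sub by (rule card_mono)
    moreover have "finite (open_cluster E \<omega> z)" using sub assms(1) by (rule finite_subset)
    ultimately show False using assms(2,3) by (simp add: larger_than_def)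
  qed
  then obtain y where "(z, y) \<in> (Restr E {w. \<omega> w})\<^sup>*" "y \<notin> gball E z n"
    using True by (auto simp: open_cluster_def Y_def)
  then show ?thesis using True by (intro arm_if_path[of \<omega> z y]) (auto simp: gball_def)
next
  case False
  \<comment> \<open>The empty cluster of a closed vertex has size 0, hence is not larger than a
    nonnegative \<open>r\<close>.\<close>
  have "0 \<le> r" using assms(2) by linarith
  then show ?thesis using assms(3) False by (simp add: larger_than_def open_cluster_def Y_def)
qed

end

section \<open>Measurability\<close>

lemma sigma_algebra_sigma_Y: "sigma_algebra UNIV (sigma_Y A)"
  unfolding sigma_Y_def by (rule sigma_algebra_sigma_sets) simp

lemma sigma_Y_mono: "A \<subseteq> B \<Longrightarrow> sigma_Y A \<subseteq> sigma_Y B"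
  unfolding sigma_Y_def by (rule sigma_sets_mono') blast

text \<open>The values on \<open>A\<close> cut the configurations into finitely many atoms, and
  \<open>S\<close> is the union of the atoms that it contains.\<close>

lemma sigma_Y_cylinder:
  assumes "finite A" and dep: "\<And>\<omega> \<omega>'. \<omega> \<in> S \<Longrightarrow> (\<And>a. a \<in> A \<Longrightarrow> \<omega> a = \<omega>' a) \<Longrightarrow> \<omega>' \<in> S"
  shows "S \<in> sigma_Y A"
proof -
  interpret sigma_algebra UNIV "sigma_Y A" by (rule sigma_algebra_sigma_Y)
  \<comment> \<open>For \<open>B \<subseteq> A\<close> this is the atom of configurations whose open
    vertices in \<open>A\<close> form \<open>B\<close>.\<close>
  let ?C = "\<lambda>B. {\<omega>\<in>UNIV. \<forall>a\<in>A. \<omega> a = (a \<in> B)}"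
  have "S = (\<Union>B\<in>{B. B \<subseteq> A \<and> ?C B \<subseteq> S}. ?C B)"
  proof (intro equalityI subsetI)
    fix \<omega> assume "\<omega> \<in> S"
    have "?C {a\<in>A. \<omega> a} \<subseteq> S"
    proof
      fix \<omega>' assume "\<omega>' \<in> ?C {a\<in>A. \<omega> a}"
      then show "\<omega>' \<in> S" by (intro dep[OF \<open>\<omega> \<in> S\<close>]) simp
    qed
    then show "\<omega> \<in> (\<Union>B\<in>{B. B \<subseteq> A \<and> ?C B \<subseteq> S}. ?C B)"
      by (intro UN_I[of "{a\<in>A. \<omega> a}"]) simp_all
  qed blast
  moreover have "?C B \<in> sigma_Y A" for B
  proof (rule sets_Collect_finite_All)
    fix a assume "a \<in> A"
    then have "Y a -` {a \<in> B} \<in> sigma_Y A"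
      unfolding sigma_Y_def by (intro sigma_sets.Basic) blast
    moreover have "{\<omega>\<in>UNIV. \<omega> a = (a \<in> B)} = Y a -` {a \<in> B}"
      by (simp add: vimage_def Y_def)
    ultimately show "{\<omega>\<in>UNIV. \<omega> a = (a \<in> B)} \<in> sigma_Y A" by metis
  qed (rule \<open>finite A\<close>)
  then have "(\<Union>B\<in>{B. B \<subseteq> A \<and> ?C B \<subseteq> S}. ?C B) \<in> sigma_Y A"
    using finite_subset[of "{B. B \<subseteq> A \<and> ?C B \<subseteq> S}" "Pow A"] \<open>finite A\<close>
    by (intro finite_UN[of _ ?C]) blast+
  ultimately show ?thesis by metis
qed

lemma (in connected_sym_graph) arm_in_sigma_Y:
  assumes "finite (gball E x n)"
  shows "arm x n \<in> sigma_Y (gball E x n)"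
proof (rule sigma_Y_cylinder[OF assms])
  fix \<omega> \<omega>' :: "'v config"
  assume \<omega>: "\<omega> \<in> arm x n" and eq: "\<And>a. a \<in> gball E x n \<Longrightarrow> \<omega> a = \<omega>' a"
  have "{w. \<omega> w} \<inter> gball E x n = {w. \<omega>' w} \<inter> gball E x n" using eq by auto
  moreover have "\<omega> x = \<omega>' x" by (rule eq) (simp add: gball_def)
  ultimately show "\<omega>' \<in> arm x n" using \<omega> by (simp add: arm_def)
qed

section \<open>Renormalization\<close>

locale decoupled_percolation = connected_sym_graph E + prob_space P
  for E :: "'v rel" and P :: "'v config measure" +
  fixes c\<^sub>u d\<^sub>u \<alpha> c\<^sub>\<alpha> :: real
  assumes c\<^sub>u_pos: "c\<^sub>u > 0" and d\<^sub>u_pos: "d\<^sub>u > 0" and volume: "volume_upper E c\<^sub>u d\<^sub>u"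
    and law: "config_law P" and decoupled: "decoupling E \<alpha> c\<^sub>\<alpha> P"
begin

lemma finite_gball: "finite (gball E x r)"
proof -
  \<comment> \<open>The volume bound speaks only of radii from 1 on.\<close>
  have "gball E x r \<subseteq> gball E x (max 1 r)" by (auto simp: gball_def)
  then show ?thesis using volume by (meson finite_subset max.cobounded1 volume_upper_def)
qed

lemma card_gball_le: "r \<ge> 1 \<Longrightarrow> card (gball E x r) \<le> c\<^sub>u * r powr d\<^sub>u"
  using volume by (simp add: volume_upper_def)

lemma arm_measurable [measurable]: "arm x n \<in> sets P"
  using arm_in_sigma_Y[OF finite_gball, of x n] sigma_Y_mono[OF subset_UNIV] law
  by (auto simp: config_law_def)

lemma prob_arm_quadruple:
  assumes "n \<ge> 1" and q: "\<And>x. prob (arm x n) \<le> q" and "c\<^sub>\<alpha> > 0"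
  shows "prob (arm x (4 * n)) \<le> c\<^sub>u * real (3 * n) powr d\<^sub>u * (q + c\<^sub>\<alpha> * n powr - \<alpha>) * q"
proof -
  let ?S = "{y. gdist E x y = 3 * n}"
  have S: "?S \<subseteq> gball E x (3 * n)" by (auto simp: gball_def)
  then have fin: "finite ?S" using finite_gball finite_subset by blast
  have q0: "0 \<le> q" using q[of x] measure_nonneg[of P "arm x n"] by linarith
  have pair: "prob (arm x n \<inter> arm y n) \<le> (q + c\<^sub>\<alpha> * n powr - \<alpha>) * q" if "y \<in> ?S" for y
  proof -
    \<comment> \<open>The triangle inequality leaves distance 3n - n = 2n, exactly the separation
      that decoupling needs; hence the choice of the sphere of radius 3n.\<close>
    have "gball E y n \<subseteq> {w. 2 * real n \<le> gdist E w x}"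
    proof
      fix w assume "w \<in> gball E y n"
      then have "gdist E w x \<ge> 2 * n"
        using that gdist_triangle[of x y w] gdist_commute[of x w] gdist_commute[of y w]
        by (auto simp: gball_def)
      then show "w \<in> {w. 2 * real n \<le> gdist E w x}" by (intro CollectI) linarith
    qed
    then have "arm y n \<in> sigma_Y {w. 2 * real n \<le> gdist E w x}"
      using arm_in_sigma_Y[OF finite_gball, of y n] sigma_Y_mono by blast
    then have "prob (arm x n \<inter> arm y n) \<le> (prob (arm x n) + c\<^sub>\<alpha> * n powr - \<alpha>) * prob (arm y n)"
      using decoupled arm_in_sigma_Y[OF finite_gball, of x n] \<open>n \<ge> 1\<close> by (simp add: decoupling_def)
    also have "\<dots> \<le> (q + c\<^sub>\<alpha> * n powr - \<alpha>) * q"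
      using q q0 \<open>c\<^sub>\<alpha> > 0\<close> by (intro mult_mono) auto
    finally show ?thesis .
  qed
  have "prob (arm x (4 * n)) \<le> prob (\<Union>y\<in>?S. arm x n \<inter> arm y n)"
    by (rule finite_measure_mono[OF arm_split sets.finite_UN[OF fin]]) simp
  also have "\<dots> \<le> (\<Sum>y\<in>?S. prob (arm x n \<inter> arm y n))"
    using fin by (intro finite_measure_subadditive_finite) auto
  also have "\<dots> \<le> card ?S * ((q + c\<^sub>\<alpha> * n powr - \<alpha>) * q)"
    by (rule sum_bounded_above) (rule pair)
  also have "\<dots> \<le> (c\<^sub>u * real (3 * n) powr d\<^sub>u) * ((q + c\<^sub>\<alpha> * n powr - \<alpha>) * q)"
  proof (rule mult_right_mono)
    have "card ?S \<le> card (gball E x (3 * n))" by (rule card_mono[OF finite_gball S])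
    then show "card ?S \<le> c\<^sub>u * real (3 * n) powr d\<^sub>u"
      using card_gball_le[of "3 * n" x] \<open>n \<ge> 1\<close> by simp
  qed (use q0 \<open>c\<^sub>\<alpha> > 0\<close> in auto)
  finally show ?thesis by (simp add: mult.assoc)
qed

text \<open>For \<open>q = n powr - \<beta>\<close>, \<open>scale\<close> bounds the prefactor in
  \<open>prob_arm_quadruple\<close> by \<open>4 powr - \<beta>\<close>, the decay demanded in
  passing from \<open>n\<close> to \<open>4 * n\<close>.\<close>

lemma prob_arm_le_powr:
  assumes "n\<^sub>0 \<ge> 1" and "c\<^sub>\<alpha> > 0"
    and scale: "\<And>n :: nat. n \<ge> n\<^sub>0 \<Longrightarrow>
      c\<^sub>u * real (3 * n) powr d\<^sub>u * (n powr - \<beta> + c\<^sub>\<alpha> * n powr - \<alpha>) \<le> 4 powr - \<beta>"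
    and small: "\<And>x. \<P>(\<omega> in P. Y x \<omega>) \<le> n\<^sub>0 powr - \<beta>"
  shows "prob (arm x (4 ^ k * n\<^sub>0)) \<le> real (4 ^ k * n\<^sub>0) powr - \<beta>"
proof (induction k arbitrary: x)
  case 0
  have "{\<omega> \<in> space P. Y x \<omega>} \<in> sets P"
  proof -
    have "{\<omega> \<in> space P. Y x \<omega>} \<in> sigma_Y {x}"
      using law by (intro sigma_Y_cylinder) (auto simp: config_law_def Y_def)
    then show ?thesis using sigma_Y_mono[OF subset_UNIV] law by (auto simp: config_law_def)
  qed
  \<comment> \<open>An arm of any length needs its starting vertex open, so the one-point bound
    starts the induction.\<close>
  then have "prob (arm x n\<^sub>0) \<le> \<P>(\<omega> in P. Y x \<omega>)"
    using law by (intro finite_measure_mono) (auto simp: arm_def Y_def config_law_def)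
  then show ?case using small[of x] by simp
next
  case (Suc k)
  define n where "n = 4 ^ k * n\<^sub>0"
  have n: "n \<ge> 1" "n \<ge> n\<^sub>0" using \<open>n\<^sub>0 \<ge> 1\<close> by (simp_all add: n_def)
  have "prob (arm x (4 * n)) \<le>
      c\<^sub>u * real (3 * n) powr d\<^sub>u * (n powr - \<beta> + c\<^sub>\<alpha> * n powr - \<alpha>) * n powr - \<beta>"
    by (rule prob_arm_quadruple[OF n(1) _ \<open>c\<^sub>\<alpha> > 0\<close>]) (simp only: Suc.IH n_def)
  also have "\<dots> \<le> 4 powr - \<beta> * n powr - \<beta>"
    using scale[OF n(2)] by (rule mult_right_mono) simp
  also have "\<dots> = real (4 * n) powr - \<beta>" by (simp add: powr_mult)
  finally show ?case by (simp add: n_def mult.assoc)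
qed

text \<open>A vertex in an infinite cluster has arms at all scales \<open>4 ^ k * n\<^sub>0\<close>,
  an event whose probability is below every term of a null sequence. As a countable union of finite
  balls, the vertex set is countable, so these null events can be united.\<close>

lemma AE_no_infinite_cluster:
  assumes "n\<^sub>0 \<ge> 1" and "\<beta> > 0"
    and arm: "\<And>x k. prob (arm x (4 ^ k * n\<^sub>0)) \<le> real (4 ^ k * n\<^sub>0) powr - \<beta>"
  shows "AE \<omega> in P. \<not> (\<exists>C \<in> open_clusters E \<omega>. infinite C)"
proof -
  have "(\<Union>n. gball E z (real n)) = UNIV" for z
    by (auto simp: gball_def)
  then have "countable (UNIV :: 'v set)"
    using finite_gball by (metis countable_UN countable_finite countableI_type)
  moreover have "AE \<omega> in P. finite (open_cluster E \<omega> z)" for z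
  proof (rule AE_I)
    let ?N = "\<Inter>k. arm z (4 ^ k * n\<^sub>0)"
    show "{\<omega> \<in> space P. \<not> finite (open_cluster E \<omega> z)} \<subseteq> ?N"
      using arm_if_larger[OF finite_gball order_refl] by (auto simp: larger_than_def)
    show N: "?N \<in> sets P" by measurable
    have le: "prob ?N \<le> real (4 ^ k * n\<^sub>0) powr - \<beta>" for k
      using arm[of z k] by (rule order_trans[rotated]) (intro finite_measure_mono; auto)
    have "(\<lambda>k. real (4 ^ k * n\<^sub>0) powr - \<beta>) \<longlonglongrightarrow> 0"
      using assms(1,2) by simp real_asymp
    then have "prob ?N \<le> 0" by (rule LIMSEQ_le_const) (use le in auto)
    then show "emeasure P ?N = 0" by (simp add: emeasure_eq_measure measure_le_0_iff)
  qed
  ultimately have "AE \<omega> in P. \<forall>z\<in>UNIV. finite (open_cluster E \<omega> z)"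
    by (subst AE_ball_countable) auto
  then show ?thesis by eventually_elim (auto simp: open_clusters_def)
qed

text \<open>A cluster larger than \<open>r\<close> forces an arm of length of order
  \<open>r powr (1 / d\<^sub>u)\<close>, so its probability is of order at most
  \<open>r powr - (\<beta> / d\<^sub>u)\<close>, which beats \<open>r powr \<theta>\<close>.\<close>

lemma cluster_size_tail:
  assumes "n\<^sub>0 \<ge> 1" and "\<theta> > 0" and \<beta>: "\<beta> > d\<^sub>u * \<theta>"
    and arm: "\<And>x k. prob (arm x (4 ^ k * n\<^sub>0)) \<le> real (4 ^ k * n\<^sub>0) powr - \<beta>"
  shows "((\<lambda>r. r powr \<theta> * \<P>(\<omega> in P. larger_than (open_cluster E \<omega> z) r)) \<longlongrightarrow> 0) at_top"
proof -
  \<comment> \<open>For positive \<open>r\<close>, the radius at which the volume bound equals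
    \<open>r\<close>.\<close>
  let ?\<rho> = "\<lambda>r. (r / c\<^sub>u) powr (1 / d\<^sub>u)"
  have \<beta>0: "\<beta> > 0" using \<beta> d\<^sub>u_pos \<open>\<theta> > 0\<close> by (meson less_trans mult_pos_pos)
  have tail: "\<P>(\<omega> in P. larger_than (open_cluster E \<omega> z) r) \<le> (?\<rho> r / 4) powr - \<beta>"
    if r: "r > 0" "?\<rho> r \<ge> n\<^sub>0" for r
  proof -
    obtain m where m: "?\<rho> r < 4 ^ m" using real_arch_pow[of 4 "?\<rho> r"] by auto
    \<comment> \<open>\<open>4 ^ k * n\<^sub>0\<close> is the largest available scale not above
      \<open>?\<rho> r\<close>. It exceeds \<open>?\<rho> r / 4\<close>, whence the 4 in the
      bound.\<close>
    define k where "k = (LEAST k. ?\<rho> r < real (4 ^ Suc k * n\<^sub>0))"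
    have "?\<rho> r < real (4 ^ Suc m * n\<^sub>0)"
    proof -
      have "(4::real) ^ m \<le> 4 ^ Suc m * real n\<^sub>0" using \<open>n\<^sub>0 \<ge> 1\<close> by simp
      with m have "?\<rho> r < 4 ^ Suc m * real n\<^sub>0" by (rule less_le_trans)
      then show ?thesis by simp
    qed
    then have upper: "?\<rho> r < real (4 ^ Suc k * n\<^sub>0)" unfolding k_def by (rule LeastI)
    have lower: "real (4 ^ k * n\<^sub>0) \<le> ?\<rho> r"
    proof (cases k)
      case (Suc j)
      then show ?thesis using not_less_Least[of j "\<lambda>k. ?\<rho> r < real (4 ^ Suc k * n\<^sub>0)"]
        by (simp add: k_def)
    qed (use r in simp)
    have n1: "real (4 ^ k * n\<^sub>0) \<ge> 1"
      using \<open>n\<^sub>0 \<ge> 1\<close> by (metis One_nat_def Suc_leI nat_0_less_mult_iff of_nat_1 of_nat_le_iff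
          zero_less_numeral zero_less_power less_le_trans zero_less_one)
    have "c\<^sub>u * real (4 ^ k * n\<^sub>0) powr d\<^sub>u \<le> c\<^sub>u * ?\<rho> r powr d\<^sub>u"
      using lower c\<^sub>u_pos d\<^sub>u_pos by (intro mult_left_mono powr_mono2) auto
    also have "\<dots> = r" using c\<^sub>u_pos d\<^sub>u_pos r by (simp add: powr_powr)
    finally have card: "card (gball E z (real (4 ^ k * n\<^sub>0))) \<le> r"
      using card_gball_le[OF n1, of z] by linarith
    then have "\<P>(\<omega> in P. larger_than (open_cluster E \<omega> z) r) \<le> prob (arm z (4 ^ k * n\<^sub>0))"
    proof (intro finite_measure_mono arm_measurable subsetI)
      fix \<omega> assume "\<omega> \<in> {\<omega> \<in> space P. larger_than (open_cluster E \<omega> z) r}"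
      then show "\<omega> \<in> arm z (4 ^ k * n\<^sub>0)"
        using arm_if_larger[OF finite_gball, of z "4 ^ k * n\<^sub>0" r \<omega>] card by blast
    qed
    also have "\<dots> \<le> real (4 ^ k * n\<^sub>0) powr - \<beta>" by (rule arm)
    also have "\<dots> \<le> (?\<rho> r / 4) powr - \<beta>"
      using upper \<beta>0 r c\<^sub>u_pos by (intro powr_mono2') auto
    finally show ?thesis .
  qed
  have "\<theta> < \<beta> / d\<^sub>u" using \<beta> d\<^sub>u_pos by (simp add: field_simps)
  then have "((\<lambda>r. (4 * c\<^sub>u powr (1 / d\<^sub>u)) powr \<beta> * r powr (\<theta> - \<beta> / d\<^sub>u)) \<longlongrightarrow> 0) at_top"
    by real_asymp
  moreover have "eventually (\<lambda>r. (4 * c\<^sub>u powr (1 / d\<^sub>u)) powr \<beta> * r powr (\<theta> - \<beta> / d\<^sub>u)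
      = r powr \<theta> * (?\<rho> r / 4) powr - \<beta>) at_top"
    using eventually_gt_at_top[of 0]
  proof eventually_elim
    case (elim r)
    then have "(?\<rho> r / 4) powr - \<beta> = (4 * c\<^sub>u powr (1 / d\<^sub>u)) powr \<beta> * r powr - (\<beta> / d\<^sub>u)"
      using c\<^sub>u_pos by (simp add: powr_divide powr_mult powr_powr powr_minus field_simps)
    moreover have "r powr (\<theta> - \<beta> / d\<^sub>u) = r powr \<theta> * r powr - (\<beta> / d\<^sub>u)"
      using powr_add[of r \<theta> "- (\<beta> / d\<^sub>u)"] by simp
    ultimately show ?case by (simp only: mult.left_commute)
  qed
  ultimately have lim: "((\<lambda>r. r powr \<theta> * (?\<rho> r / 4) powr - \<beta>) \<longlongrightarrow> 0) at_top"
    by (rule Lim_transform_eventually)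
  have "filterlim ?\<rho> at_top at_top" using c\<^sub>u_pos d\<^sub>u_pos by real_asymp
  then have "eventually (\<lambda>r. ?\<rho> r \<ge> n\<^sub>0) at_top" by (simp add: filterlim_at_top)
  then have "eventually (\<lambda>r. r powr \<theta> * \<P>(\<omega> in P. larger_than (open_cluster E \<omega> z) r)
      \<le> r powr \<theta> * (?\<rho> r / 4) powr - \<beta>) at_top"
    using eventually_gt_at_top[of 0]
    by eventually_elim (intro mult_left_mono tail, auto)
  then show ?thesis
    by (intro tendsto_sandwich[OF _ _ tendsto_const lim]) auto
qed

end

section \<open>Choice of the threshold\<close>

text \<open>Otherwise the lower bound would exceed the upper one at large radii. This serves to
  compare \<open>\<alpha>\<close> with \<open>d\<^sub>u\<close>.\<close>

lemma volume_exponents_le: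
  assumes "c\<^sub>l > 0" "volume_upper E c\<^sub>u d\<^sub>u" "volume_lower E c\<^sub>l d\<^sub>l"
  shows "d\<^sub>l \<le> d\<^sub>u"
proof (rule ccontr)
  assume "\<not> d\<^sub>l \<le> d\<^sub>u"
  then have "((\<lambda>r. r powr (d\<^sub>u - d\<^sub>l)) \<longlongrightarrow> 0) at_top" by real_asymp
  then have "((\<lambda>r. c\<^sub>u * r powr (d\<^sub>u - d\<^sub>l)) \<longlongrightarrow> 0) at_top" by (rule tendsto_mult_right_zero)
  then have "eventually (\<lambda>r. c\<^sub>u * r powr (d\<^sub>u - d\<^sub>l) < c\<^sub>l) at_top"
    using \<open>c\<^sub>l > 0\<close> by (rule order_tendstoD)
  then have "eventually (\<lambda>r. 1 \<le> r \<and> c\<^sub>u * r powr (d\<^sub>u - d\<^sub>l) < c\<^sub>l) at_top"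
    by (intro eventually_conj eventually_ge_at_top)
  then obtain r where r: "1 \<le> r" "c\<^sub>u * r powr (d\<^sub>u - d\<^sub>l) < c\<^sub>l"
    by (auto dest: eventually_happens)
  then have "c\<^sub>u * r powr d\<^sub>u < c\<^sub>l * r powr d\<^sub>l"
    by (simp add: powr_diff field_simps)
  \<comment> \<open>The upper bound includes finiteness of the balls, which rules out the infinite
    alternative in \<open>volume_lower\<close>.\<close>
  then show False
    using assms(2,3) r(1) unfolding volume_upper_def volume_lower_def by (meson not_less order_trans)
qed

text \<open>Once the factor \<open>n powr d\<^sub>u\<close> is multiplied in, both powers of
  \<open>n\<close> have negative exponents, so the expression tends to 0. The scale depends on the
  constants alone, which makes the threshold uniform in the measure.\<close>

lemma renormalization_scale:
  fixes c\<^sub>u d\<^sub>u \<alpha> \<beta> c\<^sub>\<alpha> :: real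
  assumes "\<alpha> > d\<^sub>u" "\<beta> > d\<^sub>u"
  obtains n\<^sub>0 :: nat where "n\<^sub>0 \<ge> 1"
    and "\<And>n. n \<ge> n\<^sub>0 \<Longrightarrow> c\<^sub>u * real (3 * n) powr d\<^sub>u * (n powr - \<beta> + c\<^sub>\<alpha> * n powr - \<alpha>) \<le> 4 powr - \<beta>"
proof -
  let ?f = "\<lambda>n::nat. c\<^sub>u * real (3 * n) powr d\<^sub>u * (n powr - \<beta> + c\<^sub>\<alpha> * n powr - \<alpha>)"
  let ?g = "\<lambda>n::nat. c\<^sub>u * 3 powr d\<^sub>u * (n powr (d\<^sub>u - \<beta>) + c\<^sub>\<alpha> * n powr (d\<^sub>u - \<alpha>))"
  have "(\<lambda>n::nat. n powr (d\<^sub>u - \<beta>)) \<longlonglongrightarrow> 0" "(\<lambda>n::nat. n powr (d\<^sub>u - \<alpha>)) \<longlonglongrightarrow> 0"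
    using assms by real_asymp+
  then have "?g \<longlonglongrightarrow> c\<^sub>u * 3 powr d\<^sub>u * (0 + c\<^sub>\<alpha> * 0)"
    by (intro tendsto_intros)
  moreover have "?g = ?f"
    by (simp add: fun_eq_iff powr_mult powr_diff powr_minus field_simps)
  ultimately have "?f \<longlonglongrightarrow> 0" by simp
  then have "eventually (\<lambda>n. ?f n < 4 powr - \<beta>) sequentially"
    by (rule order_tendstoD) simp
  then obtain N where "\<And>n. n \<ge> N \<Longrightarrow> ?f n < 4 powr - \<beta>"
    by (auto simp: eventually_sequentially)
  then show ?thesis by (intro that[of "max 1 N"]) (auto intro: less_imp_le)
qed

theorem theorem1p9:
  fixes E :: "'v rel" and c\<^sub>u d\<^sub>u c\<^sub>l d\<^sub>l \<alpha> c\<^sub>\<alpha> :: real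
  assumes "simple_graph E" and "infinite (UNIV :: 'v set)" and "connected_graph E"
    and "c\<^sub>u > 0" and "d\<^sub>u > 0" and "volume_upper E c\<^sub>u d\<^sub>u"
    and "c\<^sub>l > 0" and "d\<^sub>l > 0" and "volume_lower E c\<^sub>l d\<^sub>l"
    and "\<alpha> > 3 * d\<^sub>u - d\<^sub>l / 2" and "c\<^sub>\<alpha> > 0"
  shows "(\<exists>p>0. \<forall>P :: 'v config measure.
            config_law P \<and> decoupling E \<alpha> c\<^sub>\<alpha> P \<and> (SUP x. \<P>(\<omega> in P. Y x \<omega>)) < p \<longrightarrow>
            (AE \<omega> in P. \<not> (\<exists>C \<in> open_clusters E \<omega>. infinite C)))
       \<and> (\<forall>\<theta>>0. \<exists>p>0. \<forall>P :: 'v config measure.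
            config_law P \<and> decoupling E \<alpha> c\<^sub>\<alpha> P \<and> (SUP x. \<P>(\<omega> in P. Y x \<omega>)) < p \<longrightarrow>
            (\<forall>z. ((\<lambda>r. r powr \<theta> * \<P>(\<omega> in P. larger_than (open_cluster E \<omega> z) r)) \<longlongrightarrow> 0) at_top))"
proof -
  have "d\<^sub>l \<le> d\<^sub>u" using assms volume_exponents_le by blast
  \<comment> \<open>Here 3 \<open>d\<^sub>u\<close> - \<open>d\<^sub>l\<close>/2 is at least 5/2
    \<open>d\<^sub>u\<close>.\<close>
  then have \<alpha>: "\<alpha> > d\<^sub>u" using assms by linarith
  have main: "\<exists>p>0. \<forall>P :: 'v config measure.
      config_law P \<and> decoupling E \<alpha> c\<^sub>\<alpha> P \<and> (SUP x. \<P>(\<omega> in P. Y x \<omega>)) < p \<longrightarrow>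
      (AE \<omega> in P. \<not> (\<exists>C \<in> open_clusters E \<omega>. infinite C)) \<and>
      (\<forall>z. ((\<lambda>r. r powr \<theta> * \<P>(\<omega> in P. larger_than (open_cluster E \<omega> z) r)) \<longlongrightarrow> 0) at_top)"
    if "\<theta> > 0" for \<theta>
  proof -
    \<comment> \<open>Exceeds both \<open>d\<^sub>u\<close>, for the recursion, and
      \<open>d\<^sub>u * \<theta>\<close>, for the tail.\<close>
    define \<beta> where "\<beta> = d\<^sub>u * (1 + \<theta>)"
    have \<beta>: "\<beta> > d\<^sub>u" "\<beta> > d\<^sub>u * \<theta>" "\<beta> > 0"
      using that \<open>d\<^sub>u > 0\<close> by (simp_all add: \<beta>_def distrib_left add_pos_pos)
    obtain n\<^sub>0 :: nat where n\<^sub>0: "n\<^sub>0 \<ge> 1"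
      and scale: "\<And>n. n \<ge> n\<^sub>0 \<Longrightarrow>
        c\<^sub>u * real (3 * n) powr d\<^sub>u * (n powr - \<beta> + c\<^sub>\<alpha> * n powr - \<alpha>) \<le> 4 powr - \<beta>"
      using renormalization_scale[OF \<alpha> \<beta>(1)] by blast
    show ?thesis
    \<comment> \<open>The threshold is the bound demanded of arms at the initial scale, and is fixed
      before \<open>P\<close>.\<close>
    proof (intro exI[of _ "real n\<^sub>0 powr - \<beta>"] conjI allI impI)
      show "0 < real n\<^sub>0 powr - \<beta>" using n\<^sub>0 by simp
    next
      fix P :: "'v config measure"
      assume P: "config_law P \<and> decoupling E \<alpha> c\<^sub>\<alpha> P \<and> (SUP x. \<P>(\<omega> in P. Y x \<omega>)) < n\<^sub>0 powr - \<beta>"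
      then interpret prob_space P by (simp add: config_law_def)
      interpret decoupled_percolation E P c\<^sub>u d\<^sub>u \<alpha> c\<^sub>\<alpha>
        using assms P by unfold_locales (auto simp: simple_graph_def)
      \<comment> \<open>A real supremum dominates its terms only when they are bounded above, here
        by 1.\<close>
      have "\<P>(\<omega> in P. Y x \<omega>) \<le> (SUP x. \<P>(\<omega> in P. Y x \<omega>))" for x
        by (rule cSUP_upper) (auto intro!: bdd_aboveI[of _ 1])
      then have small: "\<P>(\<omega> in P. Y x \<omega>) \<le> n\<^sub>0 powr - \<beta>" for x
        using P by (meson less_imp_le order_trans)
      note arm = prob_arm_le_powr[OF n\<^sub>0 \<open>c\<^sub>\<alpha> > 0\<close> scale small]
      show "AE \<omega> in P. \<not> (\<exists>C \<in> open_clusters E \<omega>. infinite C)"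
        using n\<^sub>0 \<beta>(3) arm by (rule AE_no_infinite_cluster)
      show "((\<lambda>r. r powr \<theta> * \<P>(\<omega> in P. larger_than (open_cluster E \<omega> z) r)) \<longlongrightarrow> 0) at_top" for z
        using n\<^sub>0 that \<beta>(2) arm by (rule cluster_size_tail)
    qed
  qed
  \<comment> \<open>The first claim does not involve \<open>\<theta>\<close>, so any positive value
    yields it.\<close>
  show ?thesis using main[of 1] main by (fastforce intro: zero_less_one)
qed

end
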